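(* Let $\Gamma$ be a symmetric multiset of cardinality $N$ and let $\tilde\Gamma\subseteq\Gamma$ be a symmetric sub-multiset of cardinality $M\le N$, with $M\equiv N \pmod 2$. Set $p=0$ if $N,M$ are even and $p=-\tfrac12$ if $N,M$ are odd. Let $k\ge0$, let $B:=B^{(k)}_{N,\Gamma}$ be the normalized exponential B-spline symbol, and let $G:=1/B$. Let $\vartheta_1,\dots,\vartheta_m$ be the distinct values of $\tilde\Gamma$ with multiplicities $\tau_1,\dots,\tau_m$ in $\tilde\Gamma$. Set $z_\ell:=e^{-\vartheta_\ell/2^{k+1}}$, $z_\ell^q:=e^{-q\vartheta_\ell/2^{k+1}}$ and $$v_{\ell,i}:=2z_\ell^{p-i}\prod_{r=0}^{i-1}(p-r).$$ Then there exists a unique Laurent polynomial $c$ with the following three properties: - $c$ is odd-symmetric, i.e. $c(z)=c(z^{-1})$; - its coefficients vanish outside $[-\lceil M/2\rceil+1,\ \lceil M/2\rceil-1]$; - for $\ell=1,\dots,m$ and $s=0,\dots,\tau_\ell-1$, $$\frac{d^s c}{dz^s}(z_\ell)=\sum_{i=0}^s\binom{s}{i}v_{\ell,i}\frac{d^{s-i}G}{dz^{s-i}}(z_\ell).$$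
   Context: $\mathbb{R}^+$ denotes the positive reals, and $\lceil L\rceil:=\min\{m\in\mathbb{Z}:m\ge L\}$. Symmetric multiset: a multiset $\Gamma=\{\gamma_1,\dots,\gamma_N\}$ of complex numbers is symmetric if there exist distinct $\theta_1,\dots,\theta_q\in\mathbb{R}^+\cup\mathrm{i}[0,\pi)$ and positive integers $t_1,\dots,t_q$ such that: - $\Gamma$ consists of $\theta_j$ and $-\theta_j$, each with multiplicity $t_j$; - when $N$ is odd, $\Gamma$ contains one additional element $0$. Non-normalized exponential B-spline symbol: for a multiset $\Lambda=\{\lambda_1,\dots,\lambda_L\}$, $$\tilde B^{(k)}_{L,\Lambda}(z):=z^{-\lceil L/2\rceil}\prod_{i=1}^L\big(e^{\lambda_i/2^{k+1}}z+1\big).$$ Normalized symbol (assume $N\ge2$): fix one value $\theta_j$ from the description of $\Gamma$ and set $B^{(k)}_{N,\Gamma}:=K^{(k)}\tilde B^{(k)}_{N,\Gamma}$, where: - for $N$ even, $(K^{(k)})^{-1}=(e^{-\theta_j/2^{k+1}}+e^{\theta_j/2^{k+1}})\,\tilde B^{(k)}_{N-2,\Gamma'}(e^{\theta_j/2^{k+1}})$, with $\Gamma'$ equal to $\Gamma$ minus one copy each of $\pm\theta_j$; - for $N$ odd, $(K^{(k)})^{-1}=(e^{-\theta_j/2^{k+2}}+e^{\theta_j/2^{k+2}})(e^{-\theta_j/2^{k+1}}+e^{\theta_j/2^{k+1}})\,\tilde B^{(k)}_{N-3,\Gamma''}(e^{\theta_j/2^{k+1}})$, with $\Gamma''$ equal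 to $\Gamma$ minus one copy each of $\theta_j,-\theta_j,0$. The polynomial $c$ of the theorem is denoted $c^{(k)}_{M,\Gamma}$. The exponential pseudo-spline symbol is $a^{(k)}_{M,N,\Gamma}:=B^{(k)}_{N,\Gamma}\,c^{(k)}_{M,\Gamma}$. *)

theory Defs
  imports "HOL-Analysis.Analysis" "HOL-Library.Multiset"
begin

definition admissible_val :: "complex \<Rightarrow> bool" where
  "admissible_val \<theta> \<longleftrightarrow>
     (\<theta> \<in> \<real> \<and> Re \<theta> > 0) \<or> (Re \<theta> = 0 \<and> 0 \<le> Im \<theta> \<and> Im \<theta> < pi)"

definition symmetric_desc :: "complex multiset \<Rightarrow> complex set \<Rightarrow> (complex \<Rightarrow> nat) \<Rightarrow> bool" where
  "symmetric_desc \<Gamma> T t \<longleftrightarrow>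
     finite T \<and> (\<forall>\<theta>\<in>T. admissible_val \<theta> \<and> t \<theta> > 0) \<and>
     \<Gamma> = (\<Sum>\<theta>\<in>T. repeat_mset (t \<theta>) {#\<theta>, -\<theta>#})
          + (if odd (size \<Gamma>) then {#0#} else {#})"

definition symmetric_mset :: "complex multiset \<Rightarrow> bool" where
  "symmetric_mset \<Gamma> \<longleftrightarrow> (\<exists>T t. symmetric_desc \<Gamma> T t)"

definition Btil :: "nat \<Rightarrow> complex multiset \<Rightarrow> complex \<Rightarrow> complex" where
  "Btil k \<Lambda> z = z powi (- \<lceil>real (size \<Lambda>) / 2\<rceil>) *
     (\<Prod>\<mu>\<in>#\<Lambda>. exp (\<mu> / 2 ^ (k + 1)) * z + 1)"

definition Knorm :: "nat \<Rightarrow> complex multiset \<Rightarrow> complex \<Rightarrow> complex" where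
  "Knorm k \<Gamma> \<theta> = inverse
     (if even (size \<Gamma>) then
        (exp (- \<theta> / 2 ^ (k + 1)) + exp (\<theta> / 2 ^ (k + 1))) *
          Btil k (\<Gamma> - {#\<theta>, -\<theta>#}) (exp (\<theta> / 2 ^ (k + 1)))
      else
        (exp (- \<theta> / 2 ^ (k + 2)) + exp (\<theta> / 2 ^ (k + 2))) *
        (exp (- \<theta> / 2 ^ (k + 1)) + exp (\<theta> / 2 ^ (k + 1))) *
          Btil k (\<Gamma> - {#\<theta>, -\<theta>, 0#}) (exp (\<theta> / 2 ^ (k + 1))))"

definition Bnorm :: "nat \<Rightarrow> complex multiset \<Rightarrow> complex \<Rightarrow> complex \<Rightarrow> complex" where
  "Bnorm k \<Gamma> \<theta> z = Knorm k \<Gamma> \<theta> * Btil k \<Gamma> z"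

definition laurent_eval :: "(int \<Rightarrow> complex) \<Rightarrow> int \<Rightarrow> int \<Rightarrow> complex \<Rightarrow> complex" where
  "laurent_eval c lo hi z = (\<Sum>n\<in>{lo..hi}. c n * z powi n)"

definition pshift :: "nat \<Rightarrow> complex" where
  "pshift N = (if even N then 0 else - 1 / 2)"

text \<open>v_{l,i} = 2 z_l^{p-i} prod_{r<i} (p-r), with z_l^q = exp(-q theta_l / 2^(k+1)).\<close>
definition vcoef :: "nat \<Rightarrow> nat \<Rightarrow> complex \<Rightarrow> nat \<Rightarrow> complex" where
  "vcoef k N \<phi> i = 2 * exp (- (pshift N - of_nat i) * \<phi> / 2 ^ (k + 1)) *
                      (\<Prod>r<i. pshift N - of_nat r)"

end

theory Submission
  imports Defs "HOL-Complex_Analysis.Cauchy_Integral_Formula"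
begin

text \<open>
  The right-hand sides are, by Leibniz' rule, the derivatives at \<open>z\<^sub>\<ell>\<close> of \<open>F z = 2 z\<^sup>p G z\<close> with
  the principal power, so \<open>c\<close> has to interpolate \<open>F\<close> in the sense of Hermite at the \<open>M\<close> points
  \<open>z\<^sub>\<ell>\<close>. The symmetry of \<open>\<Gamma>\<close> gives \<open>F (1/z) = F z\<close>. Multiplying by \<open>z\<^sup>h\<close>, where \<open>h = \<lceil>M/2\<rceil> - 1\<close>,
  turns \<open>c\<close> into a polynomial of degree at most \<open>2h < M\<close>, whence uniqueness.

  For existence let \<open>q\<close>, of degree less than \<open>M\<close>, interpolate \<open>z\<^sup>h F z\<close>. Because the multiset of nodes
  is closed under inversion, the difference \<open>D\<close> of \<open>z\<^bsup>M-1-2h\<^esup> q z\<close> and \<open>z\<^bsup>M-1\<^esup> q (1/z)\<close> vanishes at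
  all nodes with multiplicity. For odd \<open>M\<close> its degree is less than \<open>M\<close>, so \<open>D = 0\<close>. For even \<open>M\<close> its
  degree is at most \<open>M\<close>, so \<open>D\<close> is a multiple of \<open>\<Prod>(z - z\<^sub>\<ell>)\<close>, whose leading and constant
  coefficients are both 1; those of \<open>D\<close> are opposite, so again \<open>D = 0\<close>. Thus \<open>q\<close> is palindromic.
\<close>

section \<open>Zeros of prescribed order of analytic functions\<close>

text \<open>For \<open>f\<close> analytic at \<open>a\<close> this is a zero of order at least
  \<open>n\<close>. With \<open>n = count A a\<close> for every \<open>a\<close> it expresses
  homogeneous Hermite conditions on a multiset \<open>A\<close> of nodes and is void off
  \<open>A\<close>.\<close>

definition jet_zero :: "(complex \<Rightarrow> complex) \<Rightarrow> complex \<Rightarrow> nat \<Rightarrow> bool" where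
  "jet_zero f a n \<longleftrightarrow> (\<forall>s<n. (deriv ^^ s) f a = 0)"

lemma jet_zero_cong:
  assumes "\<forall>\<^sub>F z in nhds a. f z = g z" "jet_zero g a n"
  shows "jet_zero f a n"
  using assms higher_deriv_cong_ev[OF assms(1) refl] by (simp add: jet_zero_def)

lemma jet_zero_Suc: "jet_zero f a (Suc n) \<longleftrightarrow> f a = 0 \<and> jet_zero (deriv f) a n"
proof -
  have "(deriv ^^ s) (deriv f) a = (deriv ^^ Suc s) f a" for s
    by (simp add: funpow_Suc_right del: funpow.simps)
  then show ?thesis
    unfolding jet_zero_def
    by (metis Suc_less_eq eq_id_iff funpow_0 less_Suc_eq_0_disj)
qed

lemma jet_zero_diff:
  assumes "f analytic_on {a}" "g analytic_on {a}" "jet_zero f a n" "jet_zero g a n"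
  shows "jet_zero (\<lambda>z. f z - g z) a n"
  using assms by (simp add: jet_zero_def higher_deriv_diff_at)

lemma jet_zero_mult:
  assumes "f analytic_on {a}" "g analytic_on {a}" "jet_zero f a n"
  shows "jet_zero (\<lambda>z. f z * g z) a n"
  using assms by (simp add: jet_zero_def higher_deriv_mult_at)

lemma analytic_on_compose_inverse:
  assumes "a \<noteq> 0" "f analytic_on {inverse a}"
  shows "(\<lambda>z::complex. f (inverse z)) analytic_on {a}"
proof -
  have "inverse analytic_on {a}"
    using assms(1) by (auto intro!: analytic_intros)
  from analytic_on_compose[OF this, of f] assms(2) show ?thesis
    by (simp add: o_def)
qed

text \<open>Induction with \<open>f\<close> generalized: the derivative of
  \<open>f (inverse z)\<close> is \<open>deriv f (inverse z)\<close> times an analytic factor, and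
  \<open>deriv f\<close> vanishes to one order less.\<close>

lemma jet_zero_compose_inverse:
  assumes "a \<noteq> 0" "f analytic_on {inverse a}" "jet_zero f (inverse a) n"
  shows "jet_zero (\<lambda>z. f (inverse z)) a n"
  using assms(2,3)
proof (induction n arbitrary: f)
  case 0
  then show ?case by (simp add: jet_zero_def)
next
  case (Suc n)
  have f': "deriv f analytic_on {inverse a}"
    using Suc.prems(1) by (rule analytic_deriv)
  \<comment> \<open>The chain rule is needed on a whole neighbourhood of \<open>a\<close>, because
    its result is differentiated further.\<close>
  have "\<forall>\<^sub>F w in nhds (inverse a). f analytic_on {w}"
    using Suc.prems(1) unfolding analytic_at eventually_nhds by blast
  moreover have "filterlim inverse (nhds (inverse a)) (nhds a)"
    using assms(1) by (intro tendsto_inverse filterlim_ident)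
  ultimately have "\<forall>\<^sub>F z in nhds a. f analytic_on {inverse z}"
    by (rule eventually_compose_filterlim)
  moreover have "\<forall>\<^sub>F z in nhds a. z \<noteq> 0"
    using assms(1) by (rule t1_space_nhds)
  ultimately have ev: "\<forall>\<^sub>F z in nhds a.
      deriv (\<lambda>z. f (inverse z)) z = deriv f (inverse z) * (- (inverse z ^ 2))"
  proof eventually_elim
    case (elim z)
    have "(f has_field_derivative deriv f (inverse z)) (at (inverse z))"
      using elim(1) analytic_on_imp_differentiable_at field_differentiable_derivI by blast
    moreover have "(inverse has_field_derivative - (inverse z ^ 2)) (at z)"
      using DERIV_inverse[OF elim(2)] by (simp add: numeral_2_eq_2)
    ultimately show ?case
      by (intro DERIV_imp_deriv DERIV_chain2[where f = f])
  qed
  have "jet_zero (\<lambda>z. deriv f (inverse z) * (- (inverse z ^ 2))) a n"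
  proof (rule jet_zero_mult)
    show "(\<lambda>z. deriv f (inverse z)) analytic_on {a}"
      by (intro analytic_on_compose_inverse f' assms(1))
    show "(\<lambda>z. - (inverse z ^ 2)) analytic_on {a}"
      using assms(1) by (auto intro!: analytic_intros)
    show "jet_zero (\<lambda>z. deriv f (inverse z)) a n"
      using Suc f' by (simp add: jet_zero_Suc)
  qed
  with ev have "jet_zero (deriv (\<lambda>z. f (inverse z))) a n"
    by (rule jet_zero_cong)
  with Suc.prems(2) show ?case by (simp add: jet_zero_Suc)
qed

section \<open>Zeros of polynomials with multiplicity\<close>

lemma deriv_poly: "deriv (poly p) = poly (pderiv p)" for p :: "complex poly"
  by (rule ext, rule DERIV_imp_deriv) simp

lemma higher_deriv_poly: "(deriv ^^ n) (poly p) = poly ((pderiv ^^ n) p)" for p :: "complex poly"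
  by (induction n) (simp_all add: deriv_poly)

lemma analytic_on_poly: "poly p analytic_on S" for p :: "complex poly"
proof -
  have "poly p holomorphic_on UNIV"
    using poly_DERIV[of p] unfolding holomorphic_on_def field_differentiable_def by blast
  then show ?thesis
    using analytic_on_open[of UNIV "poly p"] analytic_on_subset by blast
qed

text \<open>Differentiation lowers the order of a root by exactly one. Constants are treated apart,
  their derivative being zero.\<close>

lemma jet_zero_poly_iff: "jet_zero (poly p) a n \<longleftrightarrow> [:-a, 1:] ^ n dvd p"
proof (induction n arbitrary: p)
  case 0
  then show ?case by (simp add: jet_zero_def)
next
  case (Suc n)
  show ?case
  proof (cases "degree p = 0")
    case True
    then obtain c where "p = [:c:]" by (metis degree_eq_zeroE)
    moreover have "\<not> [:-a, 1:] ^ Suc n dvd [:c:]" if "c \<noteq> 0"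
      using that dvd_imp_degree_le[of "[:-a, 1:] ^ Suc n" "[:c:]"]
      by (auto simp: degree_power_eq simp del: power_Suc)
    ultimately show ?thesis
      by (cases "c = 0") (auto simp: jet_zero_def jet_zero_Suc simp del: power_Suc)
  next
    case False
    then have "p \<noteq> 0" "pderiv p \<noteq> 0" by (auto simp: pderiv_eq_0_iff)
    then show ?thesis
      using order_pderiv[of p a] order_root[of p a]
      by (auto simp: jet_zero_Suc deriv_poly Suc order_divides simp del: power_Suc)
  qed
qed

text \<open>Divisibility by every \<open>[:-a, 1:] ^ count A a\<close> makes \<open>A\<close> a
  sub-multiset of the roots of \<open>p\<close>.\<close>

lemma size_le_degree_if_jet_zero:
  assumes "p \<noteq> 0" "\<And>a. jet_zero (poly p) a (count A a)"
  shows "size A \<le> degree p"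
proof -
  have "A \<subseteq># proots p"
    using assms by (auto simp: subseteq_mset_def jet_zero_poly_iff order_divides)
  then show ?thesis
    using size_mset_mono size_proots_le order_trans by blast
qed

text \<open>Bounding the degree through vanishing coefficients, rather than by
  \<open>degree p < size A\<close>, covers the empty multiset.\<close>

lemma eq_0_if_jet_zero:
  assumes "\<And>i. i \<ge> size A \<Longrightarrow> coeff p i = 0" "\<And>a. jet_zero (poly p) a (count A a)"
  shows "p = 0"
  using assms size_le_degree_if_jet_zero[of p A] leading_coeff_0_iff[of p] by blast

section \<open>Hermite interpolation at a multiset of nodes\<close>

definition root_poly :: "complex multiset \<Rightarrow> complex poly" where
  "root_poly A = (\<Prod>a\<in>#A. [:-a, 1:])"

lemma root_poly_add [simp]: "root_poly (add_mset a A) = [:-a, 1:] * root_poly A"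
  by (simp add: root_poly_def)

lemma root_poly_empty [simp]: "root_poly {#} = 1"
  by (simp add: root_poly_def)

lemma root_poly_nonzero [simp]: "root_poly A \<noteq> 0"
  by (induction A) (simp_all del: mult_pCons_left)

lemma proots_root_poly [simp]: "proots (root_poly A) = A"
  by (induction A) (simp_all add: proots_mult del: mult_pCons_left)

lemma degree_root_poly [simp]: "degree (root_poly A) = size A"
  by (induction A) (simp_all add: degree_mult_eq del: mult_pCons_left)

lemma coeff_root_poly_size [simp]: "coeff (root_poly A) (size A) = 1"
proof (induction A)
  case (add a A)
  then show ?case
    using lead_coeff_mult[of "[:-a, 1:]" "root_poly A"]
    by (simp add: degree_mult_eq del: mult_pCons_left)
qed simp

lemma order_root_poly [simp]: "order a (root_poly A) = count A a"
  using count_proots[OF root_poly_nonzero, of A a] by simp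

lemma jet_zero_root_poly: "jet_zero (poly (root_poly A)) a n \<longleftrightarrow> n \<le> count A a"
  by (simp add: jet_zero_poly_iff order_divides)

text \<open>Newton's scheme: the condition for a new node is met by adding a multiple of
  \<open>root_poly A\<close>, which leaves the earlier conditions intact.\<close>

lemma hermite_interpolation:
  assumes "\<And>a. a \<in># A \<Longrightarrow> f analytic_on {a}"
  shows "\<exists>q. (\<forall>i\<ge>size A. coeff q i = 0) \<and> (\<forall>a. jet_zero (\<lambda>z. poly q z - f z) a (count A a))"
  using assms
proof (induction A)
  case empty
  then show ?case by (auto simp: jet_zero_def intro: exI[of _ 0])
next
  case (add a A)
  then obtain q where q: "\<And>i. i \<ge> size A \<Longrightarrow> coeff q i = 0"
      "\<And>b. jet_zero (\<lambda>z. poly q z - f z) b (count A b)"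
    by auto
  define P n where "P = root_poly A" and "n = count A a"
  \<comment> \<open>Adding \<open>a\<close> creates one new condition, on the \<open>n\<close>-th
    derivative at \<open>a\<close>: \<open>e\<close> is the defect of \<open>q\<close> in it and
    \<open>d\<close> the effect of \<open>P\<close> on it.\<close>
  define d e where "d = (deriv ^^ n) (poly P) a" and "e = (deriv ^^ n) (\<lambda>z. poly q z - f z) a"
  define q' where "q' = q - smult (e / d) P"
  \<comment> \<open>Otherwise \<open>P\<close> would vanish at \<open>a\<close> to an order beyond
    the multiplicity of \<open>a\<close> in \<open>A\<close>.\<close>
  have "d \<noteq> 0"
  proof
    assume "d = 0"
    then have "jet_zero (poly P) a (Suc n)"
      using jet_zero_root_poly[of A a n] by (auto simp: jet_zero_def less_Suc_eq d_def P_def n_def)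
    then show False by (simp add: P_def jet_zero_root_poly n_def)
  qed
  have higher: "(deriv ^^ s) (\<lambda>z. poly q' z - f z) b =
      (deriv ^^ s) (\<lambda>z. poly q z - f z) b - e / d * (deriv ^^ s) (poly P) b"
    if "f analytic_on {b}" for s b
  proof -
    have "(deriv ^^ s) (\<lambda>z. poly q' z - f z) b =
        (deriv ^^ s) (\<lambda>z. (poly q z - f z) - poly (smult (e / d) P) z) b"
      by (simp add: q'_def algebra_simps)
    also have "\<dots> = (deriv ^^ s) (\<lambda>z. poly q z - f z) b
        - (deriv ^^ s) (poly (smult (e / d) P)) b"
      using that by (intro higher_deriv_diff_at analytic_intros analytic_on_poly)
    also have "(deriv ^^ s) (poly (smult (e / d) P)) b = e / d * (deriv ^^ s) (poly P) b"
      by (simp only: higher_deriv_poly higher_pderiv_smult poly_smult)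
    finally show ?thesis .
  qed
  have old: "(deriv ^^ s) (\<lambda>z. poly q' z - f z) b = 0" if "s < count A b" for s b
  proof -
    have "b \<in># A" using that by (metis count_inI less_zeroE)
    then show ?thesis
      using add.prems higher q(2) that jet_zero_root_poly[of A b "count A b"]
      by (auto simp: jet_zero_def P_def)
  qed
  have new: "(deriv ^^ n) (\<lambda>z. poly q' z - f z) a = 0"
    using \<open>d \<noteq> 0\<close> add.prems higher by (simp add: d_def e_def)
  have "coeff q' i = 0" if "i \<ge> size (add_mset a A)" for i
    using that q(1)[of i] by (simp add: q'_def P_def coeff_eq_0)
  moreover have "jet_zero (\<lambda>z. poly q' z - f z) b (count (add_mset a A) b)" for b
    using old[of _ b] new by (auto simp: jet_zero_def less_Suc_eq n_def)
  ultimately show ?case by blast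
qed

section \<open>Symmetry of the interpolant under inversion\<close>

lemma count_image_mset_inj_on:
  assumes "inj_on f (insert x (set_mset A))"
  shows "count (image_mset f A) (f x) = count A x"
  using assms by (induction A) (auto simp: inj_on_def)

lemma poly_root_poly_0: "poly (root_poly A) 0 = (-1) ^ size A * prod_mset A"
  by (induction A) auto

text \<open>Here \<open>q z\<close> stands for \<open>z ^ h * c z\<close>, so
  \<open>c (1/z) = c z\<close> means that the coefficients of \<open>q\<close> are symmetric about
  the index \<open>h\<close>. For even \<open>size A\<close> the plain interpolant may have degree
  \<open>2 * h + 1\<close>; that its top coefficient vanishes comes out along with the
  symmetry.\<close>

lemma palindromic_hermite_interpolation:
  assumes nz: "0 \<notin># A" and inv: "image_mset inverse A = A" and prod1: "prod_mset A = 1"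
    and size: "size A = 2 * h + 1 \<or> size A = 2 * h + 2"
    and F: "\<And>a. a \<in># A \<Longrightarrow> F analytic_on {a}"
    and Fsym: "\<And>a. a \<in># A \<Longrightarrow> \<forall>\<^sub>F z in nhds a. F (inverse z) = F z"
  obtains q where "\<And>i. i > 2 * h \<Longrightarrow> coeff q i = 0"
    and "\<And>i. i \<le> 2 * h \<Longrightarrow> coeff q (2 * h - i) = coeff q i"
    and "\<And>a. jet_zero (\<lambda>z. poly q z - z ^ h * F z) a (count A a)"
proof -
  define M where "M = size A"
  have count_inv: "count A (inverse a) = count A a" for a
    using count_image_mset_inj_on[where f = inverse and x = a and A = A] inv by (simp add: inj_on_def)
  have "\<exists>q. (\<forall>i\<ge>size A. coeff q i = 0) \<and>
      (\<forall>a. jet_zero (\<lambda>z. poly q z - z ^ h * F z) a (count A a))"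
    by (intro hermite_interpolation analytic_intros F)
  then obtain q where deg: "\<And>i. i \<ge> M \<Longrightarrow> coeff q i = 0"
      and jet: "\<And>a. jet_zero (\<lambda>z. poly q z - z ^ h * F z) a (count A a)"
    by (auto simp: M_def)
  \<comment> \<open>\<open>R\<close> is \<open>z ^ (M - 1) * q (1/z)\<close>: the reversal is with
    respect to \<open>M - 1\<close>, whatever the degree of \<open>q\<close>.\<close>
  define R where "R = (\<Sum>i<M. monom (coeff q (M - 1 - i)) i)"
  \<comment> \<open>The exponent \<open>M - 1 - 2 * h\<close> is 0 for odd and 1 for even
    \<open>M\<close>. It makes both terms interpolate the same function
    \<open>z ^ (M - 1 - h) * F z\<close>.\<close>
  define D where "D = monom 1 (M - 1 - 2 * h) * q - R"
  have coeff_R: "coeff R i = (if i < M then coeff q (M - 1 - i) else 0)" for i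
    by (simp add: R_def coeff_sum)
  have coeff_D: "coeff D i = (if i < M - 1 - 2 * h then 0 else coeff q (i - (M - 1 - 2 * h))) - coeff R i" for i
    by (simp add: D_def coeff_monom_mult)
  have poly_R: "poly R z = z ^ (M - 1) * poly q (inverse z)" if "z \<noteq> 0" for z
  proof -
    have "poly q (inverse z) = (\<Sum>i<M. coeff q i * inverse z ^ i)"
    proof -
      have "degree q < M"
      proof (cases "q = 0")
        case True
        then show ?thesis using size by (auto simp: M_def)
      next
        case False
        then show ?thesis using deg[of "degree q"] by (metis leading_coeff_0_iff not_le)
      qed
      then show ?thesis
        unfolding poly_altdef by (intro sum.mono_neutral_left) (auto simp: coeff_eq_0)
    qed
    then have "z ^ (M - 1) * poly q (inverse z) = (\<Sum>i<M. coeff q i * z ^ (M - 1 - i))"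
      using that by (auto simp: sum_distrib_left power_diff divide_simps intro!: sum.cong)
    also have "\<dots> = (\<Sum>i<M. coeff q (M - 1 - i) * z ^ i)"
      by (subst sum.nat_diff_reindex[symmetric]) (auto intro!: sum.cong)
    finally show ?thesis
      by (simp add: R_def poly_sum poly_monom)
  qed
  have jet_D: "jet_zero (poly D) a (count A a)" for a
  proof (cases "a \<in># A")
    case True
    then have a: "a \<noteq> 0" "inverse a \<in># A" "F analytic_on {a}" "F analytic_on {inverse a}"
      using nz count_inv F by (metis count_eq_zero_iff)+
    \<comment> \<open>The error \<open>E\<close> vanishes to the required order both at
      \<open>a\<close> and at \<open>inverse a\<close>, which has the same multiplicity.\<close>
    define E where "E z = poly q z - z ^ h * F z" for z
    have E: "E analytic_on {a}" "E analytic_on {inverse a}"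
      unfolding E_def using a by (auto intro!: analytic_intros analytic_on_poly)
    have jet_E: "jet_zero E b (count A b)" for b
      using jet unfolding E_def .
    have "jet_zero (\<lambda>z. E z * z ^ (M - 1 - 2 * h)) a (count A a)"
      by (intro jet_zero_mult E jet_E analytic_intros)
    moreover have "jet_zero (\<lambda>z. E (inverse z) * z ^ (M - 1)) a (count A a)"
      using jet_E[of "inverse a"] count_inv[of a]
      by (intro jet_zero_mult jet_zero_compose_inverse analytic_on_compose_inverse a(1) E analytic_intros) auto
    ultimately have "jet_zero (\<lambda>z. E z * z ^ (M - 1 - 2 * h) - E (inverse z) * z ^ (M - 1)) a (count A a)"
      by (intro jet_zero_diff analytic_on_mult analytic_on_compose_inverse a(1) E analytic_intros)
    \<comment> \<open>The contributions of \<open>F\<close> cancel by its symmetry.\<close>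
    moreover have "\<forall>\<^sub>F z in nhds a. poly D z = E z * z ^ (M - 1 - 2 * h) - E (inverse z) * z ^ (M - 1)"
      using Fsym[OF True] t1_space_nhds[OF a(1)]
    proof eventually_elim
      case (elim z)
      have "M - 1 = (M - 1 - 2 * h) + h + h" using size by (auto simp: M_def)
      then have "z ^ (M - 1) = z ^ (M - 1 - 2 * h) * z ^ h * z ^ h"
        by (metis power_add)
      then have "z ^ h * z ^ (M - 1 - 2 * h) = inverse z ^ h * z ^ (M - 1)"
        using elim(2) by (simp add: field_simps)
      then show ?case
        using elim by (simp add: D_def E_def poly_monom poly_R algebra_simps)
    qed
    ultimately show ?thesis by (rule jet_zero_cong[rotated])
  qed (simp add: jet_zero_def not_in_iff)
  have "D = 0 \<and> (M = 2 * h + 2 \<longrightarrow> coeff q (M - 1) = 0)"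
  proof (cases "M = 2 * h + 1")
    case True
    then have "coeff D i = 0" if "i \<ge> M" for i
      using that deg by (simp add: coeff_D coeff_R)
    then have "D = 0"
      using jet_D unfolding M_def by (rule eq_0_if_jet_zero)
    with True show ?thesis by simp
  next
    case False
    then have M: "M = 2 * h + 2" using size M_def by auto
    define r where "r = coeff q (M - 1)"
    \<comment> \<open>The top coefficient comes from the shifted \<open>q\<close> alone, the
      constant one from \<open>R\<close> alone.\<close>
    have top: "coeff D M = r" and bottom: "coeff D 0 = - r"
      by (simp_all add: coeff_D coeff_R M r_def)
    \<comment> \<open>As \<open>root_poly A\<close> is monic of degree \<open>M\<close>, this brings
      the degree below \<open>M\<close> and keeps the zeros.\<close>
    define D' where "D' = D - smult r (root_poly A)"
    have "coeff D' i = 0" if "i \<ge> M" for i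
    proof (cases "i = M")
      case True
      then show ?thesis using top by (simp add: D'_def M_def)
    next
      case False
      with that show ?thesis
        using deg[of "i - 1"] by (simp add: D'_def coeff_D coeff_R M coeff_eq_0 M_def[symmetric])
    qed
    moreover have "jet_zero (poly D') a (count A a)" for a
      using jet_D jet_zero_root_poly[of A a "count A a"]
      by (simp add: D'_def jet_zero_poly_iff dvd_diff dvd_smult)
    ultimately have "D' = 0"
      unfolding M_def by (rule eq_0_if_jet_zero)
    then have D: "D = smult r (root_poly A)" by (simp add: D'_def)
    \<comment> \<open>The sign \<open>(-1) ^ M\<close> is 1 because \<open>M\<close> is
      even.\<close>
    have "poly (root_poly A) 0 = 1"
      using M prod1 by (simp add: poly_root_poly_0 M_def)
    then have "r = - r"
      using bottom D by (simp flip: poly_0_coeff_0)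
    then have "r = 0" by simp
    with D show ?thesis by (auto simp: r_def)
  qed
  then have D0: "D = 0" and top: "M = 2 * h + 2 \<Longrightarrow> coeff q (M - 1) = 0" by auto
  show thesis
  proof
    show "coeff q i = 0" if "i > 2 * h" for i
    proof (cases "i \<ge> M")
      case False
      with that size have "M = 2 * h + 2" "i = M - 1" by (auto simp: M_def)
      then show ?thesis using top by simp
    qed (rule deg)
    show "coeff q (2 * h - i) = coeff q i" if "i \<le> 2 * h" for i
      \<comment> \<open>At this shifted index the two contributions to \<open>D\<close> are
        \<open>coeff q i\<close> and \<open>coeff q (2 * h - i)\<close>.\<close>
      using coeff_D[of "i + (M - 1 - 2 * h)"] coeff_R[of "i + (M - 1 - 2 * h)"] that size D0
      by (auto simp: M_def split: if_splits)
    show "jet_zero (\<lambda>z. poly q z - z ^ h * F z) a (count A a)" for a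
      by (rule jet)
  qed
qed

section \<open>Hermite interpolation by symmetric Laurent polynomials\<close>

definition laurent_poly :: "nat \<Rightarrow> (int \<Rightarrow> complex) \<Rightarrow> complex poly" where
  "laurent_poly h c = (\<Sum>i\<le>2*h. monom (c (int i - int h)) i)"

lemma coeff_laurent_poly: "coeff (laurent_poly h c) i = (if i \<le> 2 * h then c (int i - int h) else 0)"
  by (simp add: laurent_poly_def coeff_sum)

lemma laurent_eval_eq_poly:
  assumes "z \<noteq> 0"
  shows "laurent_eval c (- int h) (int h) z * z ^ h = poly (laurent_poly h c) z"
proof -
  have "laurent_eval c (- int h) (int h) z = (\<Sum>i\<le>2*h. c (int i - int h) * z powi (int i - int h))"
    unfolding laurent_eval_def
    by (rule sum.reindex_bij_witness[of _ "\<lambda>i. int i - int h" "\<lambda>n. nat (n + int h)"]) auto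
  then show ?thesis
    using assms by (simp add: laurent_poly_def poly_sum poly_monom sum_distrib_right power_int_diff)
qed

lemma analytic_on_laurent_eval:
  assumes "a \<noteq> 0"
  shows "laurent_eval c lo hi analytic_on {a}"
  unfolding laurent_eval_def using assms by (intro analytic_intros) auto

text \<open>Near the nodes \<open>z ^ h\<close> is analytic and nonzero, so multiplying by it
  preserves orders of zeros. Existence then comes from the palindromic \<open>q\<close>; the
  difference of two solutions becomes a polynomial of degree at most \<open>2 * h\<close> with
  \<open>size A > 2 * h\<close> zeros.\<close>

lemma symmetric_laurent_hermite_interpolation:
  assumes nz: "0 \<notin># A" and inv: "image_mset inverse A = A" and prod1: "prod_mset A = 1"
    and size: "size A = 2 * h + 1 \<or> size A = 2 * h + 2"
    and F: "\<And>a. a \<in># A \<Longrightarrow> F analytic_on {a}"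
    and Fsym: "\<And>a. a \<in># A \<Longrightarrow> \<forall>\<^sub>F z in nhds a. F (inverse z) = F z"
  defines "L \<equiv> \<lambda>c. laurent_eval c (- int h) (int h)"
  shows "\<exists>!c. (\<forall>z. z \<noteq> 0 \<longrightarrow> L c z = L c (inverse z)) \<and>
     (\<forall>n. n \<notin> {- int h..int h} \<longrightarrow> c n = 0) \<and>
     (\<forall>a\<in>set_mset A. jet_zero (\<lambda>z. L c z - F z) a (count A a))"
proof -
  obtain q where deg: "\<And>i. i > 2 * h \<Longrightarrow> coeff q i = 0"
    and pal: "\<And>i. i \<le> 2 * h \<Longrightarrow> coeff q (2 * h - i) = coeff q i"
    and jet: "\<And>a. jet_zero (\<lambda>z. poly q z - z ^ h * F z) a (count A a)"
    using palindromic_hermite_interpolation[OF nz inv prod1 size F Fsym] by blast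
  have L_an: "L c analytic_on {a}" if "a \<noteq> 0" for a c
    unfolding L_def using that by (rule analytic_on_laurent_eval)
  show ?thesis
  proof (rule ex_ex1I)
    \<comment> \<open>The coefficients of \<open>q\<close> shifted down by \<open>h\<close>. The
      case distinction matters below the range, where \<open>nat\<close> would return index
      0.\<close>
    define c where "c n = (if n \<in> {- int h..int h} then coeff q (nat (n + int h)) else 0)" for n
    have c_minus: "c (- n) = c n" for n
    proof (cases "n \<in> {- int h..int h}")
      case True
      then have "nat (- n + int h) = 2 * h - nat (n + int h)" "nat (n + int h) \<le> 2 * h" by auto
      then show ?thesis using True pal by (simp add: c_def)
    qed (auto simp: c_def)
    have "L c z = L c (inverse z)" for z
      unfolding L_def laurent_eval_def
      by (rule sum.reindex_bij_witness[of _ uminus uminus])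
        (auto simp: c_minus power_int_minus power_int_inverse)
    moreover have "jet_zero (\<lambda>z. L c z - F z) a (count A a)" if "a \<in># A" for a
    proof -
      have a: "a \<noteq> 0" using that nz by auto
      have "laurent_poly h c = q"
        by (rule poly_eqI) (auto simp: coeff_laurent_poly c_def deg)
      then have "L c z - F z = (poly q z - z ^ h * F z) * inverse z ^ h" if "z \<noteq> 0" for z
        using that laurent_eval_eq_poly[of z c h] by (simp add: L_def field_simps)
      then have "\<forall>\<^sub>F z in nhds a. L c z - F z = (poly q z - z ^ h * F z) * inverse z ^ h"
        using t1_space_nhds[OF a] by (rule eventually_mono[rotated])
      moreover have "jet_zero (\<lambda>z. (poly q z - z ^ h * F z) * inverse z ^ h) a (count A a)"
        using a F[OF that] by (intro jet_zero_mult analytic_intros analytic_on_poly jet) auto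
      ultimately show ?thesis by (rule jet_zero_cong)
    qed
    ultimately show "\<exists>c. (\<forall>z. z \<noteq> 0 \<longrightarrow> L c z = L c (inverse z)) \<and>
       (\<forall>n. n \<notin> {- int h..int h} \<longrightarrow> c n = 0) \<and>
       (\<forall>a\<in>set_mset A. jet_zero (\<lambda>z. L c z - F z) a (count A a))"
      by (intro exI[of _ c]) (auto simp: c_def)
  next
    fix c c'
    assume c: "(\<forall>z. z \<noteq> 0 \<longrightarrow> L c z = L c (inverse z)) \<and>
       (\<forall>n. n \<notin> {- int h..int h} \<longrightarrow> c n = 0) \<and>
       (\<forall>a\<in>set_mset A. jet_zero (\<lambda>z. L c z - F z) a (count A a))"
      and c': "(\<forall>z. z \<noteq> 0 \<longrightarrow> L c' z = L c' (inverse z)) \<and>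
       (\<forall>n. n \<notin> {- int h..int h} \<longrightarrow> c' n = 0) \<and>
       (\<forall>a\<in>set_mset A. jet_zero (\<lambda>z. L c' z - F z) a (count A a))"
    let ?p = "laurent_poly h c - laurent_poly h c'"
    have "jet_zero (poly ?p) a (count A a)" for a
    proof (cases "a \<in># A")
      case True
      then have a: "a \<noteq> 0" using nz by auto
      have "poly ?p z = ((L c z - F z) - (L c' z - F z)) * z ^ h" if "z \<noteq> 0" for z
        using laurent_eval_eq_poly[OF that, of c h] laurent_eval_eq_poly[OF that, of c' h]
        by (simp add: L_def algebra_simps)
      then have "\<forall>\<^sub>F z in nhds a. poly ?p z = ((L c z - F z) - (L c' z - F z)) * z ^ h"
        using t1_space_nhds[OF a] by (rule eventually_mono[rotated])
      moreover have "jet_zero (\<lambda>z. ((L c z - F z) - (L c' z - F z)) * z ^ h) a (count A a)"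
        using True c c' a
        by (intro jet_zero_mult jet_zero_diff[of "\<lambda>z. L c z - F z" _ "\<lambda>z. L c' z - F z"]
            analytic_intros F L_an) auto
      ultimately show ?thesis by (rule jet_zero_cong)
    qed (simp add: jet_zero_def not_in_iff)
    moreover have "coeff ?p i = 0" if "i \<ge> size A" for i
      using that size by (auto simp: coeff_laurent_poly)
    ultimately have p: "?p = 0" by (intro eq_0_if_jet_zero[of A])
    show "c = c'"
    proof
      fix n
      show "c n = c' n"
      proof (cases "n \<in> {- int h..int h}")
        case True
        have "coeff (laurent_poly h c) (nat (n + int h)) = coeff (laurent_poly h c') (nat (n + int h))"
          using p by simp
        with True show ?thesis by (simp add: coeff_laurent_poly nat_le_iff)
      qed (use c c' in auto)
    qed
  qed
qed

section \<open>Principal powers on the slit plane\<close>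

text \<open>Source of the products in \<open>vcoef\<close>. The point \<open>a\<close> stays
  arbitrary in the induction, since the formula must hold on a neighbourhood before it is
  differentiated; the slit plane is open.\<close>

lemma higher_deriv_powr:
  fixes a :: complex
  assumes "a \<notin> \<real>\<^sub>\<le>\<^sub>0"
  shows "(deriv ^^ n) (\<lambda>z. c * z powr p) a = c * (\<Prod>r<n. p - of_nat r) * a powr (p - of_nat n)"
  using assms
proof (induction n arbitrary: a)
  case (Suc n)
  have "\<forall>\<^sub>F z in nhds a. z \<in> - \<real>\<^sub>\<le>\<^sub>0"
    using Suc.prems by (intro eventually_nhds_in_open) (auto intro!: open_Compl closed_nonpos_Reals_complex)
  then have "\<forall>\<^sub>F z in nhds a. (deriv ^^ n) (\<lambda>z. c * z powr p) z =
      c * (\<Prod>r<n. p - of_nat r) * z powr (p - of_nat n)"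
    by (rule eventually_mono) (simp add: Suc.IH)
  then have "(deriv ^^ Suc n) (\<lambda>z. c * z powr p) a =
      deriv (\<lambda>z. c * (\<Prod>r<n. p - of_nat r) * z powr (p - of_nat n)) a"
    by (simp add: deriv_cong_ev)
  also have "\<dots> = c * (\<Prod>r<n. p - of_nat r) * ((p - of_nat n) * a powr (p - of_nat n - 1))"
    by (intro DERIV_imp_deriv DERIV_cmult has_field_derivative_powr Suc.prems)
  finally show ?case by (simp add: algebra_simps)
qed simp

lemma powr_inverse_complex:
  fixes z :: complex
  assumes "z \<notin> \<real>\<^sub>\<le>\<^sub>0"
  shows "inverse z powr s = z powr (- s)"
  using assms by (auto simp: powr_def Ln_inverse)

section \<open>Symmetry and zeros of the B-spline symbol\<close>

text \<open>Invariance under negation governs the symbol under inversion; the strip keeps the zeros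
  of the symbol away from the nodes.\<close>

lemma symmetric_descD:
  assumes "symmetric_desc \<Gamma> T t"
  shows "image_mset uminus \<Gamma> = \<Gamma>" and "\<forall>\<mu>\<in>#\<Gamma>. \<bar>Im \<mu>\<bar> < pi"
proof -
  define S where "S U = (\<Sum>\<theta>\<in>U. repeat_mset (t \<theta>) {#\<theta>, -\<theta>#})" for U
  have \<Gamma>: "\<Gamma> = S T + (if odd (size \<Gamma>) then {#0#} else {#})"
    and T: "finite T" "\<And>\<theta>. \<theta> \<in> T \<Longrightarrow> admissible_val \<theta>"
    using assms unfolding symmetric_desc_def S_def by auto
  have rep: "image_mset uminus (repeat_mset n {#\<theta>, -\<theta>#}) = repeat_mset n {#\<theta>, -\<theta>#}" for n and \<theta> :: complex
    by (induction n) (simp_all add: add_mset_commute)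
  have "image_mset uminus (S U) = S U \<and> set_mset (S U) \<subseteq> U \<union> uminus ` U" if "finite U" for U
    using that by induction (auto simp: S_def rep)
  from this[OF T(1)] have S: "image_mset uminus (S T) = S T" "set_mset (S T) \<subseteq> T \<union> uminus ` T"
    by auto
  show "image_mset uminus \<Gamma> = \<Gamma>"
    by (subst (1 2) \<Gamma>) (simp add: S(1))
  have "\<bar>Im \<theta>\<bar> < pi" if "\<theta> \<in> T" for \<theta>
    using T(2)[OF that] pi_gt_zero by (auto simp: admissible_val_def complex_is_Real_iff)
  then have "\<forall>\<mu>\<in>#S T. \<bar>Im \<mu>\<bar> < pi"
    using S(2) by fastforce
  then show "\<forall>\<mu>\<in>#\<Gamma>. \<bar>Im \<mu>\<bar> < pi"
    by (subst \<Gamma>) auto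
qed

lemma sum_mset_eq_0_if_uminus_invariant:
  fixes \<Gamma> :: "complex multiset"
  assumes "image_mset uminus \<Gamma> = \<Gamma>"
  shows "sum_mset \<Gamma> = 0"
proof -
  have "sum_mset (image_mset uminus \<Gamma>) = - sum_mset \<Gamma>"
    by (induction \<Gamma>) auto
  with assms show ?thesis by simp
qed

lemma prod_mset_exp: "(\<Prod>\<mu>\<in>#\<Gamma>. exp (\<mu> / w)) = exp (sum_mset \<Gamma> / w)" for w :: complex
  by (induction \<Gamma>) (auto simp: exp_add add_divide_distrib)

text \<open>Each factor satisfies \<open>e / z + 1 = e * (1/z) * (z / e + 1)\<close>. The product of
  the exponentials \<open>e\<close> is 1 because \<open>\<Gamma>\<close> sums to 0, and passing to
  \<open>1 / e\<close> permutes the factors. The powers of \<open>z\<close> balance for even size;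
  for odd size the ceiling leaves one factor \<open>z\<close>.\<close>

lemma Btil_inverse:
  assumes sym: "image_mset uminus \<Gamma> = \<Gamma>" and "z \<noteq> 0"
  shows "Btil k \<Gamma> (inverse z) = (if even (size \<Gamma>) then 1 else z) * Btil k \<Gamma> z"
proof -
  define w :: complex where "w = 2 ^ (k + 1)"
  define P where "P u = (\<Prod>\<mu>\<in>#\<Gamma>. exp (\<mu> / w) * u + 1)" for u
  have "exp (\<mu> / w) * inverse z + 1 = exp (\<mu> / w) * (inverse z * (exp (- \<mu> / w) * z + 1))" for \<mu>
    using \<open>z \<noteq> 0\<close> by (simp add: exp_minus field_simps)
  then have "P (inverse z) = (\<Prod>\<mu>\<in>#\<Gamma>. exp (\<mu> / w)) * (inverse z ^ size \<Gamma> *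
      (\<Prod>\<mu>\<in>#\<Gamma>. exp (- \<mu> / w) * z + 1))"
    by (simp add: P_def prod_mset.distrib)
  also have "(\<Prod>\<mu>\<in>#\<Gamma>. exp (\<mu> / w)) = 1"
    by (simp add: prod_mset_exp sum_mset_eq_0_if_uminus_invariant[OF sym])
  also have "(\<Prod>\<mu>\<in>#\<Gamma>. exp (- \<mu> / w) * z + 1) = (\<Prod>\<mu>\<in>#image_mset uminus \<Gamma>. exp (\<mu> / w) * z + 1)"
    by (simp add: image_mset.compositionality o_def)
  also have "\<dots> = P z"
    by (simp add: sym P_def)
  finally have P: "P (inverse z) = inverse z ^ size \<Gamma> * P z" by simp
  have B: "Btil k \<Gamma> u = u powi (- \<lceil>real (size \<Gamma>) / 2\<rceil>) * P u" for u
    by (simp add: Btil_def P_def w_def)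
  show ?thesis
  proof (cases "even (size \<Gamma>)")
    case True
    then obtain m where m: "size \<Gamma> = 2 * m" by (auto elim: evenE)
    have "inverse z powi (- int m) * inverse z ^ (2 * m) = z powi (- int m)"
      using \<open>z \<noteq> 0\<close> by (simp add: power_int_minus power_inverse mult_2 power_add)
    then show ?thesis
      unfolding B P using True m by (simp flip: mult.assoc)
  next
    case False
    then obtain m where m: "size \<Gamma> = 2 * m + 1" by (auto elim: oddE)
    have "\<lceil>real (size \<Gamma>) / 2\<rceil> = int (m + 1)"
      unfolding m by (intro ceiling_unique) auto
    moreover have "inverse z powi (- int (m + 1)) * inverse z ^ (2 * m + 1) = z * z powi (- int (m + 1))"
    proof -
      have "inverse z powi (- int (m + 1)) = z ^ (m + 1)" "z powi (- int (m + 1)) = inverse (z ^ (m + 1))"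
        by (simp_all only: power_int_minus power_int_of_nat power_inverse inverse_inverse_eq)
      then show ?thesis
        using \<open>z \<noteq> 0\<close> by (simp add: power_inverse mult_2 power_add)
    qed
    ultimately show ?thesis
      unfolding B P using False m by (simp flip: mult.assoc)
  qed
qed

lemma Im_div_power2:
  assumes "\<bar>Im \<phi>\<bar> < b"
  shows "\<bar>Im (\<phi> / 2 ^ (k + 1))\<bar> < b / 2"
proof -
  have "(2::complex) ^ (k + 1) = of_real (2 ^ (k + 1))" by simp
  then have "\<bar>Im (\<phi> / 2 ^ (k + 1))\<bar> = \<bar>Im \<phi>\<bar> / 2 ^ (k + 1)"
    by (simp only: Im_divide_of_real abs_divide) simp
  also have "\<dots> \<le> \<bar>Im \<phi>\<bar> / 2"
    by (intro divide_left_mono) auto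
  finally show ?thesis using assms by linarith
qed

lemma exp_not_nonpos_Reals:
  assumes "\<bar>Im z\<bar> < pi / 2"
  shows "exp z \<notin> \<real>\<^sub>\<le>\<^sub>0"
proof -
  have "cos (Im z) > 0"
    using assms by (intro cos_gt_zero_pi) linarith+
  then have "Re (exp z) > 0" by (simp add: Re_exp)
  then show ?thesis by (auto simp: complex_nonpos_Reals_iff)
qed

text \<open>A vanishing factor would give \<open>exp x = -1\<close> with
  \<open>x = (\<mu> - \<phi>) / 2 ^ (k + 1)\<close>. But the imaginary part of
  \<open>\<mu> - \<phi>\<close> is below \<open>2 * pi\<close> in modulus and is at least halved, so
  \<open>x\<close> lies in the range of \<open>Ln\<close> and cannot be
  \<open>\<i> * pi\<close>.\<close>

lemma Btil_exp_nonzero: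
  assumes "\<forall>\<mu>\<in>#\<Gamma>. \<bar>Im \<mu>\<bar> < pi" "\<bar>Im \<phi>\<bar> < pi"
  shows "Btil k \<Gamma> (exp (- \<phi> / 2 ^ (k + 1))) \<noteq> 0"
proof -
  have "exp (\<mu> / 2 ^ (k + 1)) * exp (- \<phi> / 2 ^ (k + 1)) + 1 \<noteq> 0" if "\<mu> \<in># \<Gamma>" for \<mu>
  proof
    define x where "x = (\<mu> - \<phi>) / 2 ^ (k + 1)"
    assume "exp (\<mu> / 2 ^ (k + 1)) * exp (- \<phi> / 2 ^ (k + 1)) + 1 = 0"
    moreover have "exp x = exp (\<mu> / 2 ^ (k + 1)) * exp (- \<phi> / 2 ^ (k + 1))"
      by (simp add: x_def diff_divide_distrib flip: exp_add)
    ultimately have "exp x = - 1"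
      by (simp only: eq_neg_iff_add_eq_0)
    have "\<bar>Im (\<mu> - \<phi>)\<bar> < 2 * pi"
      using assms that by fastforce
    then have "\<bar>Im x\<bar> < pi"
      using Im_div_power2[of "\<mu> - \<phi>" "2 * pi" k] unfolding x_def by linarith
    then have "x = Ln (exp x)"
      by (intro Ln_exp[symmetric]) linarith+
    also have "\<dots> = \<i> * pi"
      using \<open>exp x = - 1\<close> by simp
    finally show False
      using \<open>\<bar>Im x\<bar> < pi\<close> by simp
  qed
  then show ?thesis
    by (auto simp: Btil_def prod_mset_zero_iff)
qed

lemma analytic_on_Btil:
  assumes "a \<noteq> 0"
  shows "Btil k \<Gamma> analytic_on {a}"
proof -
  have "(\<lambda>z. \<Prod>\<mu>\<in>#\<Gamma>. exp (\<mu> / 2 ^ (k + 1)) * z + 1) analytic_on {a}"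
    by (induction \<Gamma>) (auto intro!: analytic_intros)
  then show ?thesis
    unfolding Btil_def using assms by (intro analytic_intros) auto
qed

section \<open>Translation of the derivative conditions into Hermite interpolation\<close>

theorem mainTheorem8:
  fixes \<Gamma> \<Gamma>t :: "complex multiset" and T :: "complex set" and t :: "complex \<Rightarrow> nat"
    and \<theta> :: complex and k :: nat
  assumes desc: "symmetric_desc \<Gamma> T t"
    and theta: "\<theta> \<in> T"
    and N2: "size \<Gamma> \<ge> 2"
    and sub: "\<Gamma>t \<subseteq># \<Gamma>"
    and symt: "symmetric_mset \<Gamma>t"
    and par: "even (size \<Gamma>) \<longleftrightarrow> even (size \<Gamma>t)"
  defines "G \<equiv> (\<lambda>z. 1 / Bnorm k \<Gamma> \<theta> z)"
    and "hi \<equiv> \<lceil>real (size \<Gamma>t) / 2\<rceil> - 1"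
  shows "\<exists>!c :: int \<Rightarrow> complex.
           (\<forall>z. z \<noteq> 0 \<longrightarrow> laurent_eval c (- hi) hi z = laurent_eval c (- hi) hi (inverse z)) \<and>
           (\<forall>n. n \<notin> {- hi..hi} \<longrightarrow> c n = 0) \<and>
           (\<forall>\<phi>\<in>set_mset \<Gamma>t. \<forall>s<count \<Gamma>t \<phi>.
              (deriv ^^ s) (laurent_eval c (- hi) hi) (exp (- \<phi> / 2 ^ (k + 1))) =
              (\<Sum>i\<le>s. of_nat (s choose i) * vcoef k (size \<Gamma>) \<phi> i *
                  (deriv ^^ (s - i)) G (exp (- \<phi> / 2 ^ (k + 1)))))"
proof (cases "\<Gamma>t = {#}")
  case True
  \<comment> \<open>The support interval is empty, so only \<open>c = 0\<close> qualifies. The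
    natural number \<open>h\<close> below could not represent this bound.\<close>
  then have "hi = -1" by (simp add: hi_def)
  with True show ?thesis
    by (intro ex1I[of _ "\<lambda>_. 0"]) (auto simp: laurent_eval_def)
next
  case False
  define e :: "complex \<Rightarrow> complex" where "e \<phi> = exp (- \<phi> / 2 ^ (k + 1))" for \<phi>
  define A where "A = image_mset e \<Gamma>t"
  define p where "p = pshift (size \<Gamma>)"
  define F where "F z = 2 * z powr p * G z" for z
  define h where "h = (size \<Gamma>t - 1) div 2"
  have pos: "size \<Gamma>t > 0" using False by (simp add: nonempty_has_size)
  have hi: "hi = int h"
  proof -
    have "\<lceil>real (size \<Gamma>t) / 2\<rceil> = int (h + 1)"
      unfolding h_def using pos by (intro ceiling_unique) linarith+
    then show ?thesis by (simp add: hi_def)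
  qed
  have size: "size A = 2 * h + 1 \<or> size A = 2 * h + 2"
    using pos by (auto simp: A_def h_def)
  note sym = symmetric_descD(1)[OF desc] and strip = symmetric_descD(2)[OF desc]
  have symt': "image_mset uminus \<Gamma>t = \<Gamma>t"
    using symt symmetric_descD(1) by (auto simp: symmetric_mset_def)
  have stript: "\<bar>Im \<phi>\<bar> < pi" if "\<phi> \<in># \<Gamma>t" for \<phi>
    using strip mset_subset_eqD[OF sub that] by blast
  have Im_e: "\<bar>Im (- \<phi> / 2 ^ (k + 1))\<bar> < pi / 2" if "\<phi> \<in># \<Gamma>t" for \<phi>
    using Im_div_power2[of "- \<phi>" pi k] stript[OF that] by simp
  have e_slit: "e \<phi> \<notin> \<real>\<^sub>\<le>\<^sub>0" if "\<phi> \<in># \<Gamma>t" for \<phi>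
    unfolding e_def by (rule exp_not_nonpos_Reals[OF Im_e[OF that]])
  \<comment> \<open>The exponents lie where \<open>Ln\<close> inverts \<open>exp\<close>. Hence
    principal powers of the nodes are the prescribed \<open>z_l^q\<close>, and distinct values give
    distinct nodes, so multiplicities do not merge.\<close>
  have Ln_e: "Ln (e \<phi>) = - \<phi> / 2 ^ (k + 1)" if "\<phi> \<in># \<Gamma>t" for \<phi>
    unfolding e_def using Im_e[OF that] by (intro Ln_exp) linarith+
  have "inj_on e (set_mset \<Gamma>t)"
    by (rule inj_on_inverseI[of _ "\<lambda>z. - Ln z * 2 ^ (k + 1)"]) (simp add: Ln_e)
  then have count_A: "count A (e \<phi>) = count \<Gamma>t \<phi>" if "\<phi> \<in># \<Gamma>t" for \<phi>
    unfolding A_def using that by (intro count_image_mset_inj_on) (simp add: insert_absorb)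
  have e0: "e \<phi> \<noteq> 0" for \<phi> by (simp add: e_def)
  have G_an: "G analytic_on {e \<phi>}" if "\<phi> \<in># \<Gamma>t" for \<phi>
  proof -
    have "(\<lambda>z. inverse (Knorm k \<Gamma> \<theta>) * inverse (Btil k \<Gamma> z)) analytic_on {e \<phi>}"
      using Btil_exp_nonzero[OF strip stript[OF that], of k] e0
      by (intro analytic_intros analytic_on_Btil) (auto simp: e_def)
    then show ?thesis by (simp add: G_def Bnorm_def divide_inverse)
  qed
  have powr_an: "(\<lambda>z. 2 * z powr p) analytic_on {e \<phi>}" if "\<phi> \<in># \<Gamma>t" for \<phi>
    using e_slit[OF that] by (intro analytic_intros) auto
  have "\<exists>!c. (\<forall>z. z \<noteq> 0 \<longrightarrow> laurent_eval c (- int h) (int h) z = laurent_eval c (- int h) (int h) (inverse z)) \<and>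
     (\<forall>n. n \<notin> {- int h..int h} \<longrightarrow> c n = 0) \<and>
     (\<forall>a\<in>set_mset A. jet_zero (\<lambda>z. laurent_eval c (- int h) (int h) z - F z) a (count A a))"
  proof (rule symmetric_laurent_hermite_interpolation)
    show "0 \<notin># A" using e0 by (metis A_def imageE set_image_mset)
    have "image_mset inverse A = image_mset e (image_mset uminus \<Gamma>t)"
      by (simp add: A_def e_def image_mset.compositionality o_def exp_minus)
    then show "image_mset inverse A = A" by (simp add: symt' A_def)
    \<comment> \<open>The sum of \<open>\<Gamma>t\<close> is 0 by its invariance under
      negation.\<close>
    have "prod_mset A = exp (sum_mset \<Gamma>t / - (2 ^ (k + 1)))"
      unfolding prod_mset_exp[symmetric] by (simp add: A_def e_def[abs_def])
    then show "prod_mset A = 1"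
      by (simp add: sum_mset_eq_0_if_uminus_invariant[OF symt'])
    show "size A = 2 * h + 1 \<or> size A = 2 * h + 2" by (rule size)
  next
    fix a assume "a \<in># A"
    then obtain \<phi> where \<phi>: "\<phi> \<in># \<Gamma>t" "a = e \<phi>" by (auto simp: A_def)
    show "F analytic_on {a}"
      unfolding F_def \<phi>(2) by (intro analytic_on_mult powr_an G_an \<phi>(1))
    have "\<forall>\<^sub>F z in nhds a. z \<in> - \<real>\<^sub>\<le>\<^sub>0"
      using e_slit \<phi> by (intro eventually_nhds_in_open) (auto intro!: open_Compl closed_nonpos_Reals_complex)
    then show "\<forall>\<^sub>F z in nhds a. F (inverse z) = F z"
    proof eventually_elim
      case (elim z)
      then have z: "z \<notin> \<real>\<^sub>\<le>\<^sub>0" "z \<noteq> 0" by auto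
      show ?case
      proof (cases "even (size \<Gamma>)")
        case True
        then show ?thesis
          using z by (simp add: F_def G_def Bnorm_def Btil_inverse[OF sym] p_def pshift_def)
      next
        case odd: False
        \<comment> \<open>This absorbs the extra factor \<open>z\<close> from the odd case of
          \<open>Btil_inverse\<close>; it is the reason for \<open>p = -1/2\<close>.\<close>
        have "z powr (1 / 2) = z * z powr (- 1 / 2)"
          using powr_add[of z 1 "- 1 / 2"] z(2) by simp
        then show ?thesis
          using z odd
          by (simp add: F_def G_def Bnorm_def Btil_inverse[OF sym] p_def pshift_def powr_inverse_complex)
      qed
    qed
  qed
  moreover have "(\<forall>a\<in>set_mset A. jet_zero (\<lambda>z. laurent_eval c (- int h) (int h) z - F z) a (count A a)) \<longleftrightarrow>
    (\<forall>\<phi>\<in>set_mset \<Gamma>t. \<forall>s<count \<Gamma>t \<phi>.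
        (deriv ^^ s) (laurent_eval c (- hi) hi) (exp (- \<phi> / 2 ^ (k + 1))) =
        (\<Sum>i\<le>s. of_nat (s choose i) * vcoef k (size \<Gamma>) \<phi> i *
            (deriv ^^ (s - i)) G (exp (- \<phi> / 2 ^ (k + 1)))))" for c
  proof -
    have F: "(deriv ^^ s) F (e \<phi>) =
        (\<Sum>i\<le>s. of_nat (s choose i) * vcoef k (size \<Gamma>) \<phi> i * (deriv ^^ (s - i)) G (e \<phi>))"
      if "\<phi> \<in># \<Gamma>t" for \<phi> s
    proof -
      \<comment> \<open>With \<open>vcoef\<close> recognized as a derivative of
        \<open>2 * z powr p\<close>, the prescribed sums are Leibniz' formula for
        \<open>F\<close>.\<close>
      have "(deriv ^^ i) (\<lambda>z. 2 * z powr p) (e \<phi>) = vcoef k (size \<Gamma>) \<phi> i" for i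
      proof -
        have "e \<phi> powr (p - of_nat i) = exp (- (p - of_nat i) * \<phi> / 2 ^ (k + 1))"
          by (simp only: powr_def e0 if_False Ln_e[OF that] times_divide_eq_right mult_minus_left mult_minus_right)
        then show ?thesis
          by (simp add: higher_deriv_powr[OF e_slit[OF that]] vcoef_def p_def)
      qed
      then show ?thesis
        unfolding F_def using higher_deriv_mult_at[OF powr_an[OF that] G_an[OF that], of s]
        by (simp add: atMost_atLeast0)
    qed
    have F_an: "F analytic_on {e \<phi>}" if "\<phi> \<in># \<Gamma>t" for \<phi>
      unfolding F_def by (intro analytic_on_mult powr_an G_an that)
    have "jet_zero (\<lambda>z. laurent_eval c (- int h) (int h) z - F z) (e \<phi>) n \<longleftrightarrow>
        (\<forall>s<n. (deriv ^^ s) (laurent_eval c (- hi) hi) (e \<phi>) = (deriv ^^ s) F (e \<phi>))"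
      if "\<phi> \<in># \<Gamma>t" for \<phi> n
      using higher_deriv_diff_at[OF analytic_on_laurent_eval[OF e0] F_an[OF that]]
      by (simp add: jet_zero_def hi)
    then have "jet_zero (\<lambda>z. laurent_eval c (- int h) (int h) z - F z) (e \<phi>) (count A (e \<phi>)) \<longleftrightarrow>
        (\<forall>s<count \<Gamma>t \<phi>. (deriv ^^ s) (laurent_eval c (- hi) hi) (e \<phi>) =
        (\<Sum>i\<le>s. of_nat (s choose i) * vcoef k (size \<Gamma>) \<phi> i * (deriv ^^ (s - i)) G (e \<phi>)))"
      if "\<phi> \<in># \<Gamma>t" for \<phi>
      using that by (simp only: F count_A)
    moreover have "set_mset A = e ` set_mset \<Gamma>t" by (simp add: A_def)
    ultimately show ?thesis by (auto simp: e_def)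
  qed
  ultimately show ?thesis by (simp only: hi)
qed

end
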